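(* For every $h\in[H+1]$, every history $\tau_h\in\mathcal H_h$ and every $b\in\mathcal B$, with $s=s_h(\tau_h)$, $$\bar V^*_h(s,b)\ \ge\ \sup\{V^\pi_h(\tau_h):\ \pi\in\Pi^D,\ C^\pi_h(\tau_h)\le b\},$$ where $\sup\emptyset=-\infty$.
   Context: Cost-accumulating MDP. Fix a horizon $H\in\mathbb N$ and $m\in\mathbb N$. A finite-horizon tabular cost-accumulating MDP consists of: - a finite state set $\mathcal S=\{1,\dots,S\}$; - finite nonempty action sets $\mathcal A_h(s)$; - transitions $P_h(\cdot\mid s,a)$; - expected rewards $r_h(s,a)$; - deterministic costs $c_h(s,a)\in\mathbb R^m$, for $h\in[H]$; - an initial state $s_0$. Histories and policies. A history is $\tau_h=(s_1,a_1,\dots,a_{h-1},s_h)$ with $s_1=s_0$; $\mathcal H_h$ is the set of histories at time $h$ and $s_h(\tau_h)$ is the last state. A deterministic policy $\pi$ maps $\tau_h$ to $\pi_h(\tau_h)\in\mathcal A_h(s_h(\tau_h))$; $\Pi^D$ is the set of such policies. Value. $V^\pi_{H+1}\equiv0$ and $V^\pi_h(\tau_h)=r_h(s,a)+\sum_{s'}P_h(s'\mid s,a)V^\pi_{h+1}(\tau_h,a,s')$, where $s=s_h(\tau_h)$ and $a=\pi_h(\tau_h)$. Vector inequalities are componentwise. SR cost. Let $f:\mathbb R^m\times\mathbb R^m\to\mathbb R^m$ satisfy: - $f$ is associative; - $f$ is componentwise non-decreasing in each argument; - $f$ is $1$-Lipschitz in each argument for $\|\cdot\|_\infty$; - $f(0,x)=f(x,0)=x$.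 Let $g:[0,1]\to[0,1]$ satisfy $g(0)=0$. Write $f_{s'}y_{s'}=f(y_1,f(y_2,\dots,y_S))$. Assume $x\mapsto f_{s'}g(p_{s'})x_{s'}$ is $1$-Lipschitz for $\|\cdot\|_\infty$ for every probability vector $p$. Then $C^\pi_{H+1}\equiv0$ and $C^\pi_h(\tau_h)=c_h(s,a)+f_{s'}g(P_h(s'\mid s,a))C^\pi_{h+1}(\tau_h,a,s')$. Budget set. $\mathcal B=\{C^\pi_h(\tau_h):\pi\in\Pi^D,h\in[H+1],\tau_h\in\mathcal H_h\}$, a finite set. Reduced optimal values. For $s\in\mathcal S$ and $b\in\mathbb R^m$, let $\bar V^*_{H+1}(s,b)=0$ if $b\ge0$ and $-\infty$ otherwise. For $h\in[H]$, $$\bar V^*_h(s,b)=\max_{(a,\mathbf b)\in\bar{\mathcal A}_h(s,b)}\Big[r_h(s,a)+\sum_{s':P_h(s'|s,a)>0}P_h(s'\mid s,a)\bar V^*_{h+1}(s',b_{s'})\Big],$$ where $\bar{\mathcal A}_h(s,b)=\{(a,\mathbf b)\in\mathcal A_h(s)\times\mathcal B^S:c_h(s,a)+f_{s'}g(P_h(s'\mid s,a))b_{s'}\le b\}$ and $\max\emptyset=-\infty$. *)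

theory Defs
  imports "HOL-Analysis.Analysis"
begin

record ('a, 'm) ca_mdp =
  horizon :: nat
  nstates :: nat
  actions :: "nat \<Rightarrow> nat \<Rightarrow> 'a set"
  transition :: "nat \<Rightarrow> nat \<Rightarrow> 'a \<Rightarrow> nat \<Rightarrow> real"
  reward :: "nat \<Rightarrow> nat \<Rightarrow> 'a \<Rightarrow> real"
  cost :: "nat \<Rightarrow> nat \<Rightarrow> 'a \<Rightarrow> real ^ 'm"
  init_state :: nat

definition states :: "('a, 'm::finite) ca_mdp \<Rightarrow> nat set" where
  "states M = {1..nstates M}"

definition prob_vector :: "nat \<Rightarrow> (nat \<Rightarrow> real) \<Rightarrow> bool" where
  "prob_vector n p \<longleftrightarrow> (\<forall>i\<in>{1..n}. 0 \<le> p i) \<and> (\<Sum>i=1..n. p i) = 1"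

definition ca_mdp :: "('a, 'm::finite) ca_mdp \<Rightarrow> bool" where
  "ca_mdp M \<longleftrightarrow>
     init_state M \<in> states M \<and>
     (\<forall>h\<in>{1..horizon M}. \<forall>s\<in>states M.
        finite (actions M h s) \<and> actions M h s \<noteq> {} \<and>
        (\<forall>a\<in>actions M h s. prob_vector (nstates M) (transition M h s a)))"

text \<open>A history \<open>(s\<^sub>1, a\<^sub>1, \<dots>, a\<^sub>h\<^sub>-\<^sub>1, s\<^sub>h)\<close> is encoded as the list of its pairs
  \<open>(s\<^sub>i, a\<^sub>i)\<close>, \<open>i < h\<close>, together with its last state \<open>s\<^sub>h\<close>.\<close>

type_synonym 'a history = "(nat \<times> 'a) list \<times> nat"

definition last_state :: "'a history \<Rightarrow> nat" where
  "last_state \<tau> = snd \<tau>"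

definition extend_hist :: "'a history \<Rightarrow> 'a \<Rightarrow> nat \<Rightarrow> 'a history" where
  "extend_hist \<tau> a s' = (fst \<tau> @ [(last_state \<tau>, a)], s')"

text \<open>Times start at 1. Successors of transition probability 0 are not excluded.\<close>

primrec histories :: "('a, 'm::finite) ca_mdp \<Rightarrow> nat \<Rightarrow> 'a history set" where
  "histories M 0 = {}"
| "histories M (Suc h) =
     (if h = 0 then {([], init_state M)}
      else {extend_hist \<tau> a s' |\<tau> a s'.
              \<tau> \<in> histories M h \<and> a \<in> actions M h (last_state \<tau>) \<and> s' \<in> states M})"

type_synonym 'a policy = "nat \<Rightarrow> 'a history \<Rightarrow> 'a"

definition det_policies :: "('a, 'm::finite) ca_mdp \<Rightarrow> 'a policy set" where
  "det_policies M = {\<pi>. \<forall>h\<in>{1..horizon M}. \<forall>\<tau>\<in>histories M h.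
                          \<pi> h \<tau> \<in> actions M h (last_state \<tau>)}"

text \<open>In the recursions below, the branch \<open>h > horizon M\<close> is the terminal time
  \<open>horizon M + 1\<close>; larger times never occur.\<close>

function V_pol :: "('a, 'm::finite) ca_mdp \<Rightarrow> 'a policy \<Rightarrow> nat \<Rightarrow> 'a history \<Rightarrow> real" where
  "V_pol M \<pi> h \<tau> =
     (if h > horizon M then 0
      else reward M h (last_state \<tau>) (\<pi> h \<tau>)
           + (\<Sum>s'\<in>states M. transition M h (last_state \<tau>) (\<pi> h \<tau>) s'
                                * V_pol M \<pi> (Suc h) (extend_hist \<tau> (\<pi> h \<tau>) s')))"
  by pat_completeness auto
termination
  by (relation "Wellfounded.measure (\<lambda>(M, \<pi>, h, \<tau>). Suc (horizon M) - h)") auto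

declare V_pol.simps [simp del]

text \<open>\<open>nest f n y = f (y 1) (f (y 2) (\<dots> (f (y (n - 1)) (y n))))\<close> for \<open>n \<ge> 1\<close>;
  in particular \<open>nest f 1 y = y 1\<close>.\<close>

definition nest :: "('v \<Rightarrow> 'v \<Rightarrow> 'v) \<Rightarrow> nat \<Rightarrow> (nat \<Rightarrow> 'v) \<Rightarrow> 'v" where
  "nest f n y = foldr (\<lambda>i z. f (y i) z) [1..<n] (y n)"

text \<open>The norm on \<open>(\<real>\<^sup>m)\<^sup>n\<close> in the last conjunct is the maximum of the sup-norms of the \<open>n\<close> blocks.\<close>

definition SR_cost ::
  "nat \<Rightarrow> (real ^ 'm \<Rightarrow> real ^ 'm \<Rightarrow> real ^ 'm::finite) \<Rightarrow> (real \<Rightarrow> real) \<Rightarrow> bool" where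
  "SR_cost n f g \<longleftrightarrow>
     (\<forall>x y z. f (f x y) z = f x (f y z)) \<and>
     (\<forall>x x' y. x \<le> x' \<longrightarrow> f x y \<le> f x' y) \<and>
     (\<forall>x y y'. y \<le> y' \<longrightarrow> f x y \<le> f x y') \<and>
     (\<forall>x x' y. infnorm (f x y - f x' y) \<le> infnorm (x - x')) \<and>
     (\<forall>x y y'. infnorm (f x y - f x y') \<le> infnorm (y - y')) \<and>
     (\<forall>x. f 0 x = x \<and> f x 0 = x) \<and>
     g \<in> {0..1} \<rightarrow> {0..1} \<and> g 0 = 0 \<and>
     (\<forall>p. prob_vector n p \<longrightarrow>
        (\<forall>x y. infnorm (nest f n (\<lambda>i. g (p i) *\<^sub>R x i) - nest f n (\<lambda>i. g (p i) *\<^sub>R y i))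
                 \<le> Max ((\<lambda>i. infnorm (x i - y i)) ` {1..n})))"

definition agg_cost ::
  "('a, 'm::finite) ca_mdp \<Rightarrow> (real ^ 'm \<Rightarrow> real ^ 'm \<Rightarrow> real ^ 'm) \<Rightarrow> (real \<Rightarrow> real)
     \<Rightarrow> nat \<Rightarrow> nat \<Rightarrow> 'a \<Rightarrow> (nat \<Rightarrow> real ^ 'm) \<Rightarrow> real ^ 'm" where
  "agg_cost M f g h s a y =
     cost M h s a + nest f (nstates M) (\<lambda>s'. g (transition M h s a s') *\<^sub>R y s')"

function C_pol ::
  "('a, 'm::finite) ca_mdp \<Rightarrow> (real ^ 'm \<Rightarrow> real ^ 'm \<Rightarrow> real ^ 'm) \<Rightarrow> (real \<Rightarrow> real)
     \<Rightarrow> 'a policy \<Rightarrow> nat \<Rightarrow> 'a history \<Rightarrow> real ^ 'm" where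
  "C_pol M f g \<pi> h \<tau> =
     (if h > horizon M then 0
      else agg_cost M f g h (last_state \<tau>) (\<pi> h \<tau>)
             (\<lambda>s'. C_pol M f g \<pi> (Suc h) (extend_hist \<tau> (\<pi> h \<tau>) s')))"
  by pat_completeness auto
termination
  by (relation "Wellfounded.measure (\<lambda>(M, f, g, \<pi>, h, \<tau>). Suc (horizon M) - h)") auto

declare C_pol.simps [simp del]

definition budgets ::
  "('a, 'm::finite) ca_mdp \<Rightarrow> (real ^ 'm \<Rightarrow> real ^ 'm \<Rightarrow> real ^ 'm) \<Rightarrow> (real \<Rightarrow> real)
     \<Rightarrow> (real ^ 'm) set" where
  "budgets M f g = {C_pol M f g \<pi> h \<tau> |\<pi> h \<tau>.
     \<pi> \<in> det_policies M \<and> h \<in> {1..horizon M + 1} \<and> \<tau> \<in> histories M h}"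

definition reduced_actions ::
  "('a, 'm::finite) ca_mdp \<Rightarrow> (real ^ 'm \<Rightarrow> real ^ 'm \<Rightarrow> real ^ 'm) \<Rightarrow> (real \<Rightarrow> real)
     \<Rightarrow> nat \<Rightarrow> nat \<Rightarrow> real ^ 'm \<Rightarrow> ('a \<times> (nat \<Rightarrow> real ^ 'm)) set" where
  "reduced_actions M f g h s b =
     {(a, bb). a \<in> actions M h s \<and> bb \<in> states M \<rightarrow>\<^sub>E budgets M f g \<and>
               agg_cost M f g h s a bb \<le> b}"

definition emax :: "ereal set \<Rightarrow> ereal" where
  "emax X = (if X = {} then - \<infinity> else Max X)"

function V_red ::
  "('a, 'm::finite) ca_mdp \<Rightarrow> (real ^ 'm \<Rightarrow> real ^ 'm \<Rightarrow> real ^ 'm) \<Rightarrow> (real \<Rightarrow> real)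
     \<Rightarrow> nat \<Rightarrow> nat \<Rightarrow> real ^ 'm \<Rightarrow> ereal" where
  "V_red M f g h s b =
     (if h > horizon M then (if 0 \<le> b then 0 else - \<infinity>)
      else emax ((\<lambda>(a, bb). ereal (reward M h s a)
               + (\<Sum>s' | s' \<in> states M \<and> transition M h s a s' > 0.
                    ereal (transition M h s a s') * V_red M f g (Suc h) s' (bb s')))
             ` reduced_actions M f g h s b))"
  by pat_completeness auto
termination
  by (relation "Wellfounded.measure (\<lambda>(M, f, g, h, s, b). Suc (horizon M) - h)") auto

declare V_red.simps [simp del]

text \<open>Finiteness of the budget set and of the reduced action sets, so that the \<open>Max\<close> in
  \<open>emax\<close> is always taken over a finite set.\<close>

lemma last_state_histories:
  assumes "ca_mdp M" "\<tau> \<in> histories M h"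
  shows "last_state \<tau> \<in> states M"
  using assms by (cases h) (auto simp: ca_mdp_def last_state_def extend_hist_def split: if_splits)

lemma extend_hist_in_histories:
  assumes "\<tau> \<in> histories M h" "a \<in> actions M h (last_state \<tau>)" "s' \<in> states M"
  shows "extend_hist \<tau> a s' \<in> histories M (Suc h)"
proof -
  have "h \<noteq> 0" using assms(1) by (intro notI) simp
  then show ?thesis using assms unfolding histories.simps(2) by (simp only: if_False) blast
qed

lemma finite_histories:
  assumes "ca_mdp M" "h \<le> Suc (horizon M)"
  shows "finite (histories M h)"
  using assms(2)
proof (induction h)
  case (Suc h)
  have "{extend_hist \<tau> a s' |\<tau> a s'. \<tau> \<in> histories M h \<and> a \<in> actions M h (last_state \<tau>) \<and> s' \<in> states M}
      = (\<Union>\<tau>\<in>histories M h. \<Union>a\<in>actions M h (last_state \<tau>). extend_hist \<tau> a ` states M)"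
    by blast
  moreover have "finite (actions M h (last_state \<tau>))" if "h \<noteq> 0" "\<tau> \<in> histories M h" for \<tau>
    using that Suc.prems assms(1) last_state_histories[OF assms(1) that(2)]
    by (auto simp: ca_mdp_def)
  ultimately show ?case using Suc by (auto simp: states_def)
qed simp

lemma nest_cong:
  assumes "n \<ge> 1" "\<And>i. i \<in> {1..n} \<Longrightarrow> y i = z i"
  shows "nest f n y = nest f n z"
  unfolding nest_def using assms by (intro foldr_cong) auto

lemma agg_cost_cong:
  assumes "ca_mdp M" "\<And>s'. s' \<in> states M \<Longrightarrow> y s' = z s'"
  shows "agg_cost M f g h s a y = agg_cost M f g h s a z"
  unfolding agg_cost_def using assms
  by (intro arg_cong2[where f="(+)"] refl nest_cong) (auto simp: ca_mdp_def states_def)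

lemma finite_budgets:
  assumes "ca_mdp M"
  shows "finite (budgets M f g)"
proof -
  let ?B = "\<lambda>h. {C_pol M f g \<pi> h \<tau> |\<pi> \<tau>. \<pi> \<in> det_policies M \<and> \<tau> \<in> histories M h}"
  have fin: "finite (?B h)" if "1 \<le> h" "h \<le> Suc (horizon M)" for h
    using that(2,1)
  proof (induction h rule: inc_induct)
    case base
    have "?B (Suc (horizon M)) \<subseteq> {0}" by (auto simp: C_pol.simps)
    then show ?case using finite_subset by blast
  next
    case (step h)
    have h: "h \<in> {1..horizon M}" using step by auto
    have "?B h \<subseteq> (\<Union>s\<in>states M. \<Union>a\<in>actions M h s.
                    agg_cost M f g h s a ` (states M \<rightarrow>\<^sub>E ?B (Suc h)))"
    proof
      fix x assume "x \<in> ?B h"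
      then obtain \<pi> \<tau> where p: "\<pi> \<in> det_policies M" "\<tau> \<in> histories M h" "x = C_pol M f g \<pi> h \<tau>"
        by blast
      define a where "a = \<pi> h \<tau>"
      have s: "last_state \<tau> \<in> states M" using last_state_histories assms p(2) by blast
      have a: "a \<in> actions M h (last_state \<tau>)" using p h by (auto simp: det_policies_def a_def)
      let ?y = "\<lambda>s'. C_pol M f g \<pi> (Suc h) (extend_hist \<tau> a s')"
      have "x = agg_cost M f g h (last_state \<tau>) a ?y"
        using h p(3) by (subst (asm) C_pol.simps) (simp add: a_def)
      also have "\<dots> = agg_cost M f g h (last_state \<tau>) a (restrict ?y (states M))"
        by (rule agg_cost_cong[OF assms]) simp
      finally have "x = agg_cost M f g h (last_state \<tau>) a (restrict ?y (states M))" .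
      moreover have "restrict ?y (states M) \<in> states M \<rightarrow>\<^sub>E ?B (Suc h)"
        using extend_hist_in_histories[OF p(2) a] p(1)
        by (simp only: restrict_PiE_iff) blast
      ultimately show "x \<in> (\<Union>s\<in>states M. \<Union>a\<in>actions M h s.
                    agg_cost M f g h s a ` (states M \<rightarrow>\<^sub>E ?B (Suc h)))"
        using s a by blast
    qed
    moreover have "finite (\<Union>s\<in>states M. \<Union>a\<in>actions M h s.
                    agg_cost M f g h s a ` (states M \<rightarrow>\<^sub>E ?B (Suc h)))"
    proof (intro finite_UN_I finite_imageI finite_PiE)
      show "finite (states M)" by (simp add: states_def)
      show "finite (actions M h s)" if "s \<in> states M" for s
        using assms h that by (auto simp: ca_mdp_def)
      show "finite (?B (Suc h))" using step.IH by simp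
    qed (simp add: states_def)
    ultimately show ?case by (rule finite_subset)
  qed
  have "budgets M f g = (\<Union>h\<in>{1..horizon M + 1}. ?B h)"
    unfolding budgets_def by blast
  then show ?thesis using fin by auto
qed

lemma finite_reduced_actions:
  assumes "ca_mdp M" "h \<in> {1..horizon M}" "s \<in> states M"
  shows "finite (reduced_actions M f g h s b)"
proof (rule finite_subset)
  show "reduced_actions M f g h s b \<subseteq> actions M h s \<times> (states M \<rightarrow>\<^sub>E budgets M f g)"
    by (auto simp: reduced_actions_def)
  show "finite (actions M h s \<times> (states M \<rightarrow>\<^sub>E budgets M f g))"
    using assms finite_budgets[OF assms(1)]
    by (intro finite_cartesian_product finite_PiE) (auto simp: ca_mdp_def states_def)
qed

end

theory Submission
  imports Defs
begin

text \<open>By backward induction on time, every policy satisfying the budget constraint is dominated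
  by the reduced value. A policy \<open>\<pi>\<close> with \<open>C\<^sup>\<pi>(\<tau>) \<le> b\<close> yields the reduced action consisting of
  its own action at \<open>\<tau>\<close> and, for each successor state, its own cost-to-go there as the next budget;
  this is feasible because these costs lie in the budget set, and \<open>\<pi>\<close> meets the next budgets with
  equality.\<close>

lemma budgetsI:
  assumes "\<pi> \<in> det_policies M" "h \<in> {1..horizon M + 1}" "\<tau> \<in> histories M h"
  shows "C_pol M f g \<pi> h \<tau> \<in> budgets M f g"
  using assms unfolding budgets_def by blast

text \<open>The given pair makes the reduced action set nonempty, so \<open>emax\<close> is a true
  \<open>Max\<close> and not its default -\<infinity>; finiteness of that set makes this
  \<open>Max\<close> an upper bound.\<close>

lemma V_red_ge:
  assumes "ca_mdp M" "h \<in> {1..horizon M}" "s \<in> states M" "(a, bb) \<in> reduced_actions M f g h s b"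
  shows "ereal (reward M h s a)
           + (\<Sum>s' | s' \<in> states M \<and> transition M h s a s' > 0.
                ereal (transition M h s a s') * V_red M f g (Suc h) s' (bb s'))
         \<le> V_red M f g h s b"
proof -
  let ?F = "\<lambda>(a, bb). ereal (reward M h s a)
               + (\<Sum>s' | s' \<in> states M \<and> transition M h s a s' > 0.
                    ereal (transition M h s a s') * V_red M f g (Suc h) s' (bb s'))"
  have "V_red M f g h s b = Max (?F ` reduced_actions M f g h s b)"
    using assms(2,4) by (subst V_red.simps) (auto simp: emax_def)
  moreover have "?F (a, bb) \<le> Max (?F ` reduced_actions M f g h s b)"
    using finite_reduced_actions[OF assms(1-3)] assms(4) by (intro Max_ge) blast+
  ultimately show ?thesis by simp
qed

lemma V_pol_le_V_red:
  assumes M: "ca_mdp M" and \<pi>: "\<pi> \<in> det_policies M"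
    and h: "1 \<le> h" "h \<le> Suc (horizon M)"
    and \<tau>: "\<tau> \<in> histories M h" and C: "C_pol M f g \<pi> h \<tau> \<le> b"
  shows "ereal (V_pol M \<pi> h \<tau>) \<le> V_red M f g h (last_state \<tau>) b"
  using h(2,1) \<tau> C
\<comment> \<open>Induction runs downward from the terminal time; history and budget vary because
  each successor state has its own.\<close>
proof (induction h arbitrary: \<tau> b rule: inc_induct)
  case base
  \<comment> \<open>The cost-to-go is 0 here, so the constraint says 0 \<le> b and selects the value
    0 instead of -\<infinity>.\<close>
  then show ?case by (simp add: V_pol.simps V_red.simps C_pol.simps)
next
  case (step h)
  have h: "h \<in> {1..horizon M}" using step.hyps step.prems(1) by auto
  define s where "s = last_state \<tau>"
  define a where "a = \<pi> h \<tau>"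
  define c where "c = (\<lambda>s'. C_pol M f g \<pi> (Suc h) (extend_hist \<tau> a s'))"
  define v where "v = (\<lambda>s'. V_pol M \<pi> (Suc h) (extend_hist \<tau> a s'))"
  define S where "S = {s'. s' \<in> states M \<and> transition M h s a s' > 0}"
  \<comment> \<open>Restriction gives the extensional function required by
    \<open>reduced_actions\<close>; the aggregated cost reads values at states only.\<close>
  define bb where "bb = restrict c (states M)"
  have s: "s \<in> states M" using last_state_histories[OF M step.prems(2)] by (simp add: s_def)
  have a: "a \<in> actions M h s" using \<pi> h step.prems(2) by (auto simp: det_policies_def a_def s_def)
  have ext: "extend_hist \<tau> a s' \<in> histories M (Suc h)" if "s' \<in> states M" for s'
    using extend_hist_in_histories[OF step.prems(2)] a that by (simp add: s_def)
  have "agg_cost M f g h s a bb = agg_cost M f g h s a c"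
    by (rule agg_cost_cong[OF M]) (simp add: bb_def)
  also have "\<dots> = C_pol M f g \<pi> h \<tau>"
    using h by (subst C_pol.simps) (simp add: s_def a_def c_def)
  also have "\<dots> \<le> b" by (rule step.prems(3))
  finally have "agg_cost M f g h s a bb \<le> b" .
  \<comment> \<open>Successors of probability 0 also extend to histories, so every coordinate is a
    budget.\<close>
  moreover have "bb \<in> states M \<rightarrow>\<^sub>E budgets M f g"
    unfolding bb_def c_def restrict_PiE_iff using h by (auto intro!: budgetsI \<pi> ext)
  ultimately have act: "(a, bb) \<in> reduced_actions M f g h s b"
    using a by (simp add: reduced_actions_def)
  have IH: "ereal (v s') \<le> V_red M f g (Suc h) s' (bb s')" if "s' \<in> states M" for s'
    using step.IH[OF _ ext[OF that], of "bb s'"] that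
    by (simp add: v_def bb_def c_def last_state_def extend_hist_def)
  have nonneg: "0 \<le> transition M h s a s'" if "s' \<in> states M" for s'
    using M h s a that by (auto simp: ca_mdp_def prob_vector_def states_def)
  \<comment> \<open>\<open>V_pol\<close> sums over all states, \<open>V_red\<close> only over those
    of positive probability; the remaining terms are 0.\<close>
  have "(\<Sum>s'\<in>states M. transition M h s a s' * v s') = (\<Sum>s'\<in>S. transition M h s a s' * v s')"
    by (rule sum.mono_neutral_right)
      (use nonneg in \<open>force simp: S_def states_def not_less dest: antisym\<close>)+
  then have "ereal (V_pol M \<pi> h \<tau>)
      = ereal (reward M h s a) + (\<Sum>s'\<in>S. ereal (transition M h s a s') * ereal (v s'))"
    using h by (subst V_pol.simps) (simp add: s_def a_def v_def)
  also have "\<dots> \<le> ereal (reward M h s a)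
      + (\<Sum>s'\<in>S. ereal (transition M h s a s') * V_red M f g (Suc h) s' (bb s'))"
    by (intro add_left_mono sum_mono ereal_mult_left_mono IH) (auto simp: S_def)
  also have "\<dots> \<le> V_red M f g h s b"
    unfolding S_def by (rule V_red_ge[OF M h s act])
  finally show ?case by (simp add: s_def)
qed

theorem mainTheorem5:
  fixes M :: "('a, 'm::finite) ca_mdp"
    and f :: "real ^ 'm \<Rightarrow> real ^ 'm \<Rightarrow> real ^ 'm"
    and g :: "real \<Rightarrow> real"
    and h :: nat and \<tau> :: "'a history" and b :: "real ^ 'm"
  assumes "ca_mdp M"
    and "SR_cost (nstates M) f g"
    and "h \<in> {1..horizon M + 1}"
    and "\<tau> \<in> histories M h"
    and "b \<in> budgets M f g"
  shows "V_red M f g h (last_state \<tau>) b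
           \<ge> Sup {ereal (V_pol M \<pi> h \<tau>) |\<pi>. \<pi> \<in> det_policies M \<and> C_pol M f g \<pi> h \<tau> \<le> b}"
  \<comment> \<open>If no policy is feasible, the supremum is that of the empty set, -\<infinity>,
    and the bound is vacuous.\<close>
  using assms(1,3,4) by (intro Sup_least) (auto intro: V_pol_le_V_red)

end
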